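(* Let $D$ be a defeasible theory and $S^*_D$ its compiled program for the logic ${ DL}(\partial^*_{||})$. Then $S^*_D$ is: (1) a Datalog$^\neg$ program iff $D$ is function-free; (2) variable-free iff $D$ is variable-free; (3) range-restricted iff $D$ is range-restricted; (4) safe iff $D$ is range-restricted; (5) stratified.
   Context: Defeasible theories. Terms are built from variables, constants and function symbols. A literal is an atom $p(t_1,\dots,t_n)$ or its classical negation; ${\sim}q$ is the complementary literal. A defeasible theory $D=(F,R,>)$ consists of a finite set $F$ of literals (facts), a finite set $R$ of labelled rules $r$ with finite antecedent set $A(r)$, consequent $C(r)$ and kind strict ($\to$), defeasible ($\Rightarrow$) or defeater ($\leadsto$), and an acyclic superiority relation $>$ on labels. $D$ is function-free if no rule or fact contains a function symbol other than constants; range-restricted if every fact is variable-free and every variable in the consequent of a rule also occurs in its antecedent. Compiled program. For a literal $q$ with predicate $p$, $\mathtt{q}$ denotes $\mathtt{p}$ if $q$ is positive and $\mathtt{not\_p}$ if negative; $\mathtt{{\sim}q}$ is the name of the complement; predicate names are formed by concatenation; rule labels are constants. $S^*_D$ consists exactly of: (i) for each fact $q(\vec a)$: unit clauses $\mathtt{definitely\_q}(\vec a)$, $\mathtt{lambda\_q}(\vec a)$, $\mathtt{defeasibly\_q}(\vec a)$; (ii) for each strict rule $r:q_1(\vec a_1),\dots,q_n(\vec a_n)\to q(\vec a)$: $\mathtt{definitely\_q}(\vec a)\,\text{:-}\,\mathtt{body}^\Delta_r(\vec a)$, $\mathtt{lambda\_q}(\vec a)\,\text{:-}\,\mathtt{body}^\Delta_r(\vec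 a)$, $\mathtt{defeasibly\_q}(\vec a)\,\text{:-}\,\mathtt{body}^\Delta_r(\vec a)$, $\mathtt{body}^\Delta_r(\vec a)\,\text{:-}\,\mathtt{definitely\_q_1}(\vec a_1),\dots,\mathtt{definitely\_q_n}(\vec a_n)$; (iii) for each strict or defeasible rule $r:q_1(\vec a_1),\dots,q_n(\vec a_n)\hookrightarrow q(\vec a)$: $\mathtt{lambda\_q}(\vec a)\,\text{:-}\,not\ \mathtt{definitely\_{\sim}q}(\vec a),\mathtt{body}^\lambda_r(\vec a)$ and $\mathtt{defeasibly\_q}(\vec a)\,\text{:-}\,not\ \mathtt{definitely\_{\sim}q}(\vec a),\mathtt{body}^d_r(\vec a),not\ \mathtt{overruled\_q}(r,\vec a)$; (iv) for each rule $s$ of any kind, $s:q_1(\vec a_1),\dots,q_n(\vec a_n)\hookrightarrow q(\vec a)$: $\mathtt{body}^\lambda_s(\vec a)\,\text{:-}\,\mathtt{lambda\_q_1}(\vec a_1),\dots,\mathtt{lambda\_q_n}(\vec a_n)$ and $\mathtt{body}^d_s(\vec a)\,\text{:-}\,\mathtt{defeasibly\_q_1}(\vec a_1),\dots,\mathtt{defeasibly\_q_n}(\vec a_n)$; (v) for each strict or defeasible rule $r$ with consequent literal $q$ and each rule $s$ with consequent ${\sim}q(\vec b)$: $\mathtt{overruled\_q}(r,\vec b)\,\text{:-}\,\mathtt{body}^\lambda_s(\vec b),not\ \mathtt{defeats\_q}(r,s)$; (vi) for each $r>s$ with $r$ having consequent literal $q$, the unit clause $\mathtt{defeats\_q}(r,s)$.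 Logic programs. A Datalog$^\neg$ program is one whose only terms are constants and variables. A program is range-restricted if every variable in the head of a clause appears in a positive body literal, and safe if every variable in a clause appears in a positive body literal of that clause. A program is stratified if there is a mapping $m$ from predicates to non-negative integers such that for every clause $m(\text{head})\geq m(B)$ for each positive body literal $B$ and $m(\text{head})>m(C)$ for each negative body literal $not\ C$. *)

theory Defs
  imports Main
begin

type_synonym name = string

text \<open>Constants are the terms \<open>Fun c []\<close>. Rule labels are names, and occur as constants in
  compiled programs.\<close>

datatype tm = Var name | Fun name "tm list"

abbreviation Const :: "name \<Rightarrow> tm" where
  "Const c \<equiv> Fun c []"

fun vars_tm :: "tm \<Rightarrow> name set" where
  "vars_tm (Var x) = {x}"
| "vars_tm (Fun f ts) = (\<Union>t\<in>set ts. vars_tm t)"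

text \<open>The function symbols other than constants.\<close>

fun funs_tm :: "tm \<Rightarrow> name set" where
  "funs_tm (Var x) = {}"
| "funs_tm (Fun f ts) = (if ts = [] then {} else {f}) \<union> (\<Union>t\<in>set ts. funs_tm t)"

text \<open>A literal predicate is a predicate together with a sign, so that a literal is always of the
  form \<open>q(a\<^sub>1, \<dots>, a\<^sub>n)\<close> with \<open>q\<close> a literal predicate.\<close>

datatype lpred = Pos name | Neg name

datatype lit = Lit (lit_pred: lpred) (lit_args: "tm list")

fun compl :: "lpred \<Rightarrow> lpred" where
  "compl (Pos p) = Neg p"
| "compl (Neg p) = Pos p"

definition vars_lit :: "lit \<Rightarrow> name set" where
  "vars_lit l = (\<Union>t\<in>set (lit_args l). vars_tm t)"

definition funs_lit :: "lit \<Rightarrow> name set" where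
  "funs_lit l = (\<Union>t\<in>set (lit_args l). funs_tm t)"

datatype kind = Strict | Defeasible | Defeater

record drule =
  label :: name
  antecedent :: "lit set"
  kind :: kind
  consequent :: lit

text \<open>\<open>(r, s) \<in> superiority D\<close> stands for \<open>r > s\<close>.\<close>

record dtheory =
  facts :: "lit set"
  rules :: "drule set"
  superiority :: "(name \<times> name) set"

definition defeasible_theory :: "dtheory \<Rightarrow> bool" where
  "defeasible_theory D \<longleftrightarrow>
     finite (facts D) \<and>
     finite (rules D) \<and> (\<forall>r\<in>rules D. finite (antecedent r)) \<and>
     superiority D \<subseteq> label ` rules D \<times> label ` rules D \<and> acyclic (superiority D)"

definition lits_rule :: "drule \<Rightarrow> lit set" where
  "lits_rule r = insert (consequent r) (antecedent r)"

definition function_free_theory :: "dtheory \<Rightarrow> bool" where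
  "function_free_theory D \<longleftrightarrow>
     (\<forall>l\<in>facts D. funs_lit l = {}) \<and> (\<forall>r\<in>rules D. \<forall>l\<in>lits_rule r. funs_lit l = {})"

definition variable_free_theory :: "dtheory \<Rightarrow> bool" where
  "variable_free_theory D \<longleftrightarrow>
     (\<forall>l\<in>facts D. vars_lit l = {}) \<and> (\<forall>r\<in>rules D. \<forall>l\<in>lits_rule r. vars_lit l = {})"

definition range_restricted_theory :: "dtheory \<Rightarrow> bool" where
  "range_restricted_theory D \<longleftrightarrow>
     (\<forall>l\<in>facts D. vars_lit l = {}) \<and>
     (\<forall>r\<in>rules D. vars_lit (consequent r) \<subseteq> (\<Union>l\<in>antecedent r. vars_lit l))"

datatype atom = Atom (atom_pred: name) (atom_args: "tm list")

text \<open>\<open>Naf\<close> is negation as failure, as opposed to the classical negation in \<^const>\<open>Neg\<close>.\<close>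

datatype body_lit = Holds (body_atom: atom) | Naf (body_atom: atom)

datatype clause = Clause (head: atom) (body: "body_lit set")

type_synonym program = "clause set"

definition vars_atom :: "atom \<Rightarrow> name set" where
  "vars_atom a = (\<Union>t\<in>set (atom_args a). vars_tm t)"

definition atoms_clause :: "clause \<Rightarrow> atom set" where
  "atoms_clause c = insert (head c) (body_atom ` body c)"

definition vars_clause :: "clause \<Rightarrow> name set" where
  "vars_clause c = (\<Union>a\<in>atoms_clause c. vars_atom a)"

definition pos_body_vars :: "clause \<Rightarrow> name set" where
  "pos_body_vars c = (\<Union>a\<in>{a. Holds a \<in> body c}. vars_atom a)"

definition datalog_program :: "program \<Rightarrow> bool" where
  "datalog_program P \<longleftrightarrow>
     (\<forall>c\<in>P. \<forall>a\<in>atoms_clause c. \<forall>t\<in>set (atom_args a). (\<exists>k. t = Const k) \<or> (\<exists>x. t = Var x))"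

definition variable_free_program :: "program \<Rightarrow> bool" where
  "variable_free_program P \<longleftrightarrow> (\<forall>c\<in>P. vars_clause c = {})"

definition range_restricted_program :: "program \<Rightarrow> bool" where
  "range_restricted_program P \<longleftrightarrow> (\<forall>c\<in>P. vars_atom (head c) \<subseteq> pos_body_vars c)"

definition safe_program :: "program \<Rightarrow> bool" where
  "safe_program P \<longleftrightarrow> (\<forall>c\<in>P. vars_clause c \<subseteq> pos_body_vars c)"

definition stratified :: "program \<Rightarrow> bool" where
  "stratified P \<longleftrightarrow>
     (\<exists>m :: name \<Rightarrow> nat. \<forall>c\<in>P.
        (\<forall>a. Holds a \<in> body c \<longrightarrow> m (atom_pred (head c)) \<ge> m (atom_pred a)) \<and>
        (\<forall>a. Naf a \<in> body c \<longrightarrow> m (atom_pred (head c)) > m (atom_pred a)))"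

text \<open>Predicate names are formed by concatenation. No freshness is required of the names occurring
  in the theory: a predicate of the theory may itself be called \<open>not_p\<close>.\<close>

fun pname :: "lpred \<Rightarrow> name" where
  "pname (Pos p) = p"
| "pname (Neg p) = ''not_'' @ p"

definition definitely :: "lpred \<Rightarrow> name" where
  "definitely q = ''definitely_'' @ pname q"

definition lambda :: "lpred \<Rightarrow> name" where
  "lambda q = ''lambda_'' @ pname q"

definition defeasibly :: "lpred \<Rightarrow> name" where
  "defeasibly q = ''defeasibly_'' @ pname q"

definition overruled :: "lpred \<Rightarrow> name" where
  "overruled q = ''overruled_'' @ pname q"

definition defeats :: "lpred \<Rightarrow> name" where
  "defeats q = ''defeats_'' @ pname q"

definition body_Delta :: "drule \<Rightarrow> name" where
  "body_Delta r = ''body_Delta_'' @ label r"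

definition body_lambda :: "drule \<Rightarrow> name" where
  "body_lambda r = ''body_lambda_'' @ label r"

definition body_d :: "drule \<Rightarrow> name" where
  "body_d r = ''body_d_'' @ label r"

definition tagged_body :: "(lpred \<Rightarrow> name) \<Rightarrow> drule \<Rightarrow> body_lit set" where
  "tagged_body tag r = (\<lambda>l. Holds (Atom (tag (lit_pred l)) (lit_args l))) ` antecedent r"

inductive_set compiled :: "dtheory \<Rightarrow> program" for D :: dtheory where
  fact_definitely:
    "Lit q ts \<in> facts D \<Longrightarrow> Clause (Atom (definitely q) ts) {} \<in> compiled D"
| fact_lambda:
    "Lit q ts \<in> facts D \<Longrightarrow> Clause (Atom (lambda q) ts) {} \<in> compiled D"
| fact_defeasibly:
    "Lit q ts \<in> facts D \<Longrightarrow> Clause (Atom (defeasibly q) ts) {} \<in> compiled D"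

| strict_definitely:
    "\<lbrakk>r \<in> rules D; kind r = Strict; consequent r = Lit q ts\<rbrakk> \<Longrightarrow>
     Clause (Atom (definitely q) ts) {Holds (Atom (body_Delta r) ts)} \<in> compiled D"
| strict_lambda:
    "\<lbrakk>r \<in> rules D; kind r = Strict; consequent r = Lit q ts\<rbrakk> \<Longrightarrow>
     Clause (Atom (lambda q) ts) {Holds (Atom (body_Delta r) ts)} \<in> compiled D"
| strict_defeasibly:
    "\<lbrakk>r \<in> rules D; kind r = Strict; consequent r = Lit q ts\<rbrakk> \<Longrightarrow>
     Clause (Atom (defeasibly q) ts) {Holds (Atom (body_Delta r) ts)} \<in> compiled D"
| strict_body_Delta:
    "\<lbrakk>r \<in> rules D; kind r = Strict; consequent r = Lit q ts\<rbrakk> \<Longrightarrow>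
     Clause (Atom (body_Delta r) ts) (tagged_body definitely r) \<in> compiled D"

| supportive_lambda:
    "\<lbrakk>r \<in> rules D; kind r \<in> {Strict, Defeasible}; consequent r = Lit q ts\<rbrakk> \<Longrightarrow>
     Clause (Atom (lambda q) ts)
       {Naf (Atom (definitely (compl q)) ts), Holds (Atom (body_lambda r) ts)} \<in> compiled D"
| supportive_defeasibly:
    "\<lbrakk>r \<in> rules D; kind r \<in> {Strict, Defeasible}; consequent r = Lit q ts\<rbrakk> \<Longrightarrow>
     Clause (Atom (defeasibly q) ts)
       {Naf (Atom (definitely (compl q)) ts), Holds (Atom (body_d r) ts),
        Naf (Atom (overruled q) (Const (label r) # ts))} \<in> compiled D"

| any_body_lambda:
    "\<lbrakk>s \<in> rules D; consequent s = Lit q ts\<rbrakk> \<Longrightarrow>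
     Clause (Atom (body_lambda s) ts) (tagged_body lambda s) \<in> compiled D"
| any_body_d:
    "\<lbrakk>s \<in> rules D; consequent s = Lit q ts\<rbrakk> \<Longrightarrow>
     Clause (Atom (body_d s) ts) (tagged_body defeasibly s) \<in> compiled D"

| overruling:
    "\<lbrakk>r \<in> rules D; kind r \<in> {Strict, Defeasible}; consequent r = Lit q ts;
      s \<in> rules D; consequent s = Lit (compl q) us\<rbrakk> \<Longrightarrow>
     Clause (Atom (overruled q) (Const (label r) # us))
       {Holds (Atom (body_lambda s) us),
        Naf (Atom (defeats q) [Const (label r), Const (label s)])} \<in> compiled D"

| defeating:
    "\<lbrakk>r \<in> rules D; (label r, s) \<in> superiority D; consequent r = Lit q ts\<rbrakk> \<Longrightarrow>
     Clause (Atom (defeats q) [Const (label r), Const s]) {} \<in> compiled D"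

end

theory Submission imports Defs begin

text \<open>Compilation only renames predicates and adds rule labels, which are constants, so a
  property of terms that holds for constants transfers both ways
  (\<open>compiled_all_args_iff\<close>); this covers the Datalog and variable-free claims. Range
  restriction and safety follow from a cycle: a range-restricted theory gives a safe program, a safe
  program is range-restricted, and the unit and body clauses of such a program give back the
  condition on the theory. Stratification uses four levels that depend only on the tag of a
  predicate.\<close>

lemma funs_tm_empty_iff: "funs_tm t = {} \<longleftrightarrow> (\<exists>k. t = Const k) \<or> (\<exists>x. t = Var x)"
  by (cases t) auto

lemma atoms_clause_Clause [simp]: "atoms_clause (Clause h B) = insert h (body_atom ` B)"
  by (simp add: atoms_clause_def)

lemma vars_atom_Atom [simp]: "vars_atom (Atom p ts) = (\<Union>t\<in>set ts. vars_tm t)"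
  by (simp add: vars_atom_def)

lemma body_atom_tagged_body:
  "body_atom ` tagged_body tag r = (\<lambda>l. Atom (tag (lit_pred l)) (lit_args l)) ` antecedent r"
  by (simp add: tagged_body_def image_image)

lemma pos_body_vars_simps [simp]:
  "pos_body_vars (Clause h {}) = {}"
  "pos_body_vars (Clause h (insert (Holds a) B)) = vars_atom a \<union> pos_body_vars (Clause h B)"
  "pos_body_vars (Clause h (insert (Naf a) B)) = pos_body_vars (Clause h B)"
  by (auto simp: pos_body_vars_def)

lemma pos_body_vars_tagged_body [simp]:
  "pos_body_vars (Clause h (tagged_body tag r)) = (\<Union>l\<in>antecedent r. vars_lit l)"
  by (fastforce simp: pos_body_vars_def tagged_body_def vars_lit_def)

text \<open>Every argument of a compiled atom is an argument of a fact or rule literal, or a label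
  constant, whence the hypothesis on \<open>P\<close>. Conversely, every literal of the theory
  leaves its arguments in some clause.\<close>

lemma compiled_all_args_iff:
  assumes const: "\<And>c. P (Const c)"
  shows "(\<forall>c\<in>compiled D. \<forall>a\<in>atoms_clause c. \<forall>t\<in>set (atom_args a). P t) \<longleftrightarrow>
    (\<forall>l\<in>facts D. \<forall>t\<in>set (lit_args l). P t) \<and>
    (\<forall>r\<in>rules D. \<forall>l\<in>lits_rule r. \<forall>t\<in>set (lit_args l). P t)"
    (is "?prog \<longleftrightarrow> ?facts \<and> ?rules")
proof
  assume prog: ?prog
  have ?facts
  proof
    fix l assume "l \<in> facts D"
    then have "Clause (Atom (definitely (lit_pred l)) (lit_args l)) {} \<in> compiled D"
      by (simp add: compiled.fact_definitely)
    with prog show "\<forall>t\<in>set (lit_args l). P t" by fastforce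
  qed
  moreover have ?rules
  proof
    fix r assume "r \<in> rules D"
    \<comment> \<open>This clause exists for rules of every kind, defeaters included, and carries
      the arguments of the consequent and of all antecedents.\<close>
    then have "Clause (Atom (body_lambda r) (lit_args (consequent r))) (tagged_body lambda r)
        \<in> compiled D"
      by (metis compiled.any_body_lambda lit.collapse)
    from bspec[OF prog this] show "\<forall>l\<in>lits_rule r. \<forall>t\<in>set (lit_args l). P t"
      by (auto simp: lits_rule_def body_atom_tagged_body)
  qed
  ultimately show "?facts \<and> ?rules" ..
next
  assume *: "?facts \<and> ?rules"
  have fact: "\<forall>t\<in>set ts. P t" if "Lit q ts \<in> facts D" for q ts
    using * that by fastforce
  have conseq: "\<forall>t\<in>set ts. P t" if "r \<in> rules D" "consequent r = Lit q ts" for r q ts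
    using * that by (fastforce simp: lits_rule_def)
  have ante: "\<forall>t\<in>set (lit_args l). P t" if "r \<in> rules D" "l \<in> antecedent r" for r l
    using * that by (fastforce simp: lits_rule_def)
  show ?prog
  proof
    fix c assume "c \<in> compiled D"
    then show "\<forall>a\<in>atoms_clause c. \<forall>t\<in>set (atom_args a). P t"
      by cases (auto simp: body_atom_tagged_body const dest: fact conseq ante)
  qed
qed

lemma datalog_program_compiled:
  "datalog_program (compiled D) \<longleftrightarrow> function_free_theory D"
  using compiled_all_args_iff[of "\<lambda>t. funs_tm t = {}" D]
  by (simp add: datalog_program_def function_free_theory_def funs_lit_def
      flip: funs_tm_empty_iff)

lemma variable_free_program_compiled:
  "variable_free_program (compiled D) \<longleftrightarrow> variable_free_theory D"
  using compiled_all_args_iff[of "\<lambda>t. vars_tm t = {}" D]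
  by (simp add: variable_free_program_def variable_free_theory_def vars_lit_def
      vars_clause_def vars_atom_def)

lemma safe_imp_range_restricted_program:
  "safe_program P \<Longrightarrow> range_restricted_program P"
  by (fastforce simp: safe_program_def range_restricted_program_def vars_clause_def
      atoms_clause_def)

text \<open>A unit clause has no positive body, so its head must be ground. The
  \<open>body_lambda\<close> clause has the arguments of the consequent in its head and the
  antecedents as its positive body.\<close>

lemma range_restricted_theory_if_compiled:
  assumes "range_restricted_program (compiled D)"
  shows "range_restricted_theory D"
  unfolding range_restricted_theory_def
proof (intro conjI ballI)
  fix l assume "l \<in> facts D"
  then have "Clause (Atom (definitely (lit_pred l)) (lit_args l)) {} \<in> compiled D"
    by (simp add: compiled.fact_definitely)
  with assms show "vars_lit l = {}"
    by (fastforce simp: range_restricted_program_def pos_body_vars_def vars_lit_def)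
next
  fix r assume "r \<in> rules D"
  then have "Clause (Atom (body_lambda r) (lit_args (consequent r))) (tagged_body lambda r)
      \<in> compiled D"
    by (metis compiled.any_body_lambda lit.collapse)
  with assms have "vars_atom (Atom (body_lambda r) (lit_args (consequent r)))
      \<subseteq> pos_body_vars (Clause (Atom (body_lambda r) (lit_args (consequent r)))
           (tagged_body lambda r))"
    unfolding range_restricted_program_def by fastforce
  then show "vars_lit (consequent r) \<subseteq> (\<Union>l\<in>antecedent r. vars_lit l)"
    by (simp add: vars_lit_def)
qed

text \<open>Where \<open>Naf\<close> occurs, a positive body atom of the same clause, tagged
  \<open>body_lambda\<close> or \<open>body_d\<close>, already has all the non-constant arguments.
  The hypothesis matters only for facts and for the clauses that define body predicates.\<close>

lemma safe_program_compiled: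
  assumes "range_restricted_theory D"
  shows "safe_program (compiled D)"
  unfolding safe_program_def
proof
  have fact: "(\<Union>t\<in>set ts. vars_tm t) = {}" if "Lit q ts \<in> facts D" for q ts
    using assms that by (fastforce simp: range_restricted_theory_def vars_lit_def)
  have conseq: "(\<Union>t\<in>set ts. vars_tm t) \<subseteq> (\<Union>l\<in>antecedent r. vars_lit l)"
    if "r \<in> rules D" "consequent r = Lit q ts" for q r ts
    using assms that by (force simp: range_restricted_theory_def vars_lit_def)
  have tagged: "(\<Union>a\<in>body_atom ` tagged_body tag r. vars_atom a) = (\<Union>l\<in>antecedent r. vars_lit l)"
    for tag r
    by (simp add: body_atom_tagged_body vars_lit_def)
  fix c assume "c \<in> compiled D"
  then show "vars_clause c \<subseteq> pos_body_vars c"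
    by cases (simp_all add: vars_clause_def fact conseq tagged[simplified])
qed

text \<open>The stratum is read off the first characters of the name. Since no tag is a prefix of
  another one, it is unaffected by the predicate names and rule labels of the theory.\<close>

definition stratum :: "name \<Rightarrow> nat" where
  "stratum p =
    (if take 6 p \<in> {''lambda'', ''body_l''} then 1
     else if take 6 p = ''overru'' then 2
     else if take 6 p \<in> {''defeas'', ''body_d''} then 3
     else 0)"

text \<open>Each tag has at least six characters, and six is the least number that separates
  \<open>body_d\<close> from \<open>body_l\<close> and \<open>defeas\<close> from
  \<open>defeat\<close>.\<close>

lemma stratum_simps [simp]:
  "stratum (definitely q) = 0" "stratum (body_Delta r) = 0" "stratum (defeats q) = 0"
  "stratum (lambda q) = 1" "stratum (body_lambda r) = 1"
  "stratum (overruled q) = 2"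
  "stratum (defeasibly q) = 3" "stratum (body_d r) = 3"
  by (simp_all add: stratum_def definitely_def body_Delta_def defeats_def lambda_def
      body_lambda_def overruled_def defeasibly_def body_d_def)

text \<open>Negation only leads from \<open>lambda\<close> or \<open>defeasibly\<close> to
  \<open>definitely\<close>, from \<open>defeasibly\<close> to \<open>overruled\<close>, and from
  \<open>overruled\<close> to \<open>defeats\<close>; each of these lowers the stratum, and no
  positive dependency raises it.\<close>

lemma stratified_compiled: "stratified (compiled D)"
  unfolding stratified_def
proof (intro exI ballI)
  fix c assume "c \<in> compiled D"
  then show "(\<forall>a. Holds a \<in> body c \<longrightarrow> stratum (atom_pred (head c)) \<ge> stratum (atom_pred a)) \<and>
      (\<forall>a. Naf a \<in> body c \<longrightarrow> stratum (atom_pred (head c)) > stratum (atom_pred a))"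
    by cases (auto simp: tagged_body_def)
qed

theorem theorem8:
  fixes D :: dtheory
  assumes "defeasible_theory D"
  shows "(datalog_program (compiled D) \<longleftrightarrow> function_free_theory D) \<and>
         (variable_free_program (compiled D) \<longleftrightarrow> variable_free_theory D) \<and>
         (range_restricted_program (compiled D) \<longleftrightarrow> range_restricted_theory D) \<and>
         (safe_program (compiled D) \<longleftrightarrow> range_restricted_theory D) \<and>
         stratified (compiled D)"
  using datalog_program_compiled variable_free_program_compiled stratified_compiled
    safe_imp_range_restricted_program range_restricted_theory_if_compiled safe_program_compiled
  by blast

end
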